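(* Let $\mathcal{V}$ be a variety with a $\mathsf{d}$-cube term ($\mathsf{d}>1$). Let $\mathbf{B}$ be a subalgebra of $\mathbf{B}_1\times\dots\times\mathbf{B}_n$ with $\mathbf{B}_1,\dots,\mathbf{B}_n\in\mathcal{V}$ and $n\ge\mathsf{d}$, let $\theta_i\in\operatorname{Con}(\mathbf{B}_i)$ for $i\in[n]$, and let $\theta:=\theta_1\times\dots\times\theta_n$. Assume $G$ is a generating set for $\mathbf{B}$ and $\Lambda,\Phi\subseteq B[\theta]$ satisfy: (1) for every $I\in\binom{[n]}{\mathsf{d}-1}$, every $\bar b\in B|_I$ and every $\bar c\in B[\theta]|_I$ with $\bar b\equiv_{\theta|_I}\bar c$, there exist $b_{I,\bar b}\in B$ and $c_{I,\bar c}\in\Lambda$ with $b_{I,\bar b}|_I=\bar b$, $c_{I,\bar c}|_I=\bar c$ and $b_{I,\bar b}\equiv_\theta c_{I,\bar c}$; (2) for every $i\in[n]$ and every $(\beta,\gamma)\in\theta_i$ with $\beta\in B|_i$, there exist $b_{i,\beta}\in B$ and $c_{i,\gamma}\in\Phi$ with $b_{i,\beta}|_i=\beta$, $c_{i,\gamma}|_i=\gamma$, $b_{i,\beta}|_{[i-1]}=c_{i,\gamma}|_{[i-1]}$ and $b_{i,\beta}\equiv_\theta c_{i,\gamma}$. Then $G\cup\Lambda\cup\Phi$ is a generating set for $\mathbf{B}[\theta]$.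
   Context: $[m]=\{1,\dots,m\}$; $\binom{S}{k}$ is the set of $k$-element subsets of $S$; $b|_I$ (resp. $B|_I$) denotes projection onto the coordinates in $I$, and $\theta|_I=\prod_{i\in I}\theta_i$. A $\mathsf{d}$-cube term for $\mathcal{V}$ is a term $t$ satisfying identities $t(M)=(y,\dots,y)^T$ where $M$ is a matrix with $\mathsf{d}$ rows, entries among the variables $x,y$, each column containing at least one $x$. $\theta=\theta_1\times\dots\times\theta_n$ is the product congruence relating tuples coordinatewise. For a congruence $\theta$ of an algebra $\mathbf{A}$ and a subalgebra $\mathbf{B}$, $\mathbf{B}[\theta]$ is the smallest subalgebra of $\mathbf{A}$ containing $\mathbf{B}$ that is a union of $\theta$-classes; its universe is $B[\theta]=\bigcup_{b\in B}b/\theta$. *)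

theory Defs
  imports Main "HOL-Library.FuncSet"
begin

text \<open>
  A similarity type is an arity function \<open>ar\<close> on a type \<open>'f\<close> of operation symbols.  The value
  \<open>oper A f xs\<close> is meaningful only for lists \<open>xs\<close> of length \<open>ar f\<close> over the universe of \<open>A\<close>.
\<close>

record ('f, 'a) ualg =
  universe :: "'a set"
  oper :: "'f \<Rightarrow> 'a list \<Rightarrow> 'a"

definition subuniverse :: "('f \<Rightarrow> nat) \<Rightarrow> ('f, 'a) ualg \<Rightarrow> 'a set \<Rightarrow> bool" where
  "subuniverse ar A S \<longleftrightarrow> S \<subseteq> universe A \<and>
     (\<forall>f xs. length xs = ar f \<and> set xs \<subseteq> S \<longrightarrow> oper A f xs \<in> S)"

definition algebra :: "('f \<Rightarrow> nat) \<Rightarrow> ('f, 'a) ualg \<Rightarrow> bool" where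
  "algebra ar A \<longleftrightarrow> universe A \<noteq> {} \<and>
     (\<forall>f xs. length xs = ar f \<and> set xs \<subseteq> universe A \<longrightarrow> oper A f xs \<in> universe A)"

definition subalgebra :: "('f \<Rightarrow> nat) \<Rightarrow> ('f, 'a) ualg \<Rightarrow> ('f, 'a) ualg \<Rightarrow> bool" where
  "subalgebra ar B A \<longleftrightarrow> algebra ar B \<and> universe B \<subseteq> universe A \<and>
     (\<forall>f xs. length xs = ar f \<and> set xs \<subseteq> universe B \<longrightarrow> oper B f xs = oper A f xs)"

definition generating_set :: "('f \<Rightarrow> nat) \<Rightarrow> ('f, 'a) ualg \<Rightarrow> 'a set \<Rightarrow> bool" where
  "generating_set ar A G \<longleftrightarrow> G \<subseteq> universe A \<and>
     \<Inter> {S. subuniverse ar A S \<and> G \<subseteq> S} = universe A"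

definition congruence :: "('f \<Rightarrow> nat) \<Rightarrow> ('f, 'a) ualg \<Rightarrow> ('a \<times> 'a) set \<Rightarrow> bool" where
  "congruence ar A \<theta> \<longleftrightarrow> equiv (universe A) \<theta> \<and>
     (\<forall>f xs ys. length xs = ar f \<and> list_all2 (\<lambda>x y. (x, y) \<in> \<theta>) xs ys \<longrightarrow>
        (oper A f xs, oper A f ys) \<in> \<theta>)"

text \<open>
  Tuples indexed by \<open>I\<close> are functions that are \<^const>\<open>undefined\<close> outside \<open>I\<close>, so the projection of
  a tuple \<open>b\<close> onto the coordinates in \<open>J\<close> is \<open>restrict b J\<close>.
\<close>

definition prod_alg :: "'i set \<Rightarrow> ('i \<Rightarrow> ('f, 'a) ualg) \<Rightarrow> ('f, 'i \<Rightarrow> 'a) ualg" where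
  "prod_alg I A = \<lparr> universe = (\<Pi>\<^sub>E i\<in>I. universe (A i)),
                    oper = (\<lambda>f xs. \<lambda>i\<in>I. oper (A i) f (map (\<lambda>x. x i) xs)) \<rparr>"

definition prod_rel :: "'i set \<Rightarrow> ('i \<Rightarrow> ('a \<times> 'a) set) \<Rightarrow> (('i \<Rightarrow> 'a) \<times> ('i \<Rightarrow> 'a)) set" where
  "prod_rel I \<theta> = {(a, b). a \<in> extensional I \<and> b \<in> extensional I \<and> (\<forall>i\<in>I. (a i, b i) \<in> \<theta> i)}"

definition saturation ::
  "('f, 'a) ualg \<Rightarrow> ('a \<times> 'a) set \<Rightarrow> ('f, 'a) ualg \<Rightarrow> ('f, 'a) ualg" where
  "saturation A \<theta> B = \<lparr> universe = (\<Union>b\<in>universe B. \<theta> `` {b}), oper = oper A \<rparr>"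

datatype ('f, 'v) uterm = Var 'v | Fun 'f "('f, 'v) uterm list"

fun wf_uterm :: "('f \<Rightarrow> nat) \<Rightarrow> ('f, 'v) uterm \<Rightarrow> bool" where
  "wf_uterm ar (Var v) = True"
| "wf_uterm ar (Fun f ts) = (length ts = ar f \<and> (\<forall>t\<in>set ts. wf_uterm ar t))"

fun vars_uterm :: "('f, 'v) uterm \<Rightarrow> 'v set" where
  "vars_uterm (Var v) = {v}"
| "vars_uterm (Fun f ts) = (\<Union>t\<in>set ts. vars_uterm t)"

fun subst_uterm :: "('v \<Rightarrow> ('f, 'w) uterm) \<Rightarrow> ('f, 'v) uterm \<Rightarrow> ('f, 'w) uterm" where
  "subst_uterm s (Var v) = s v"
| "subst_uterm s (Fun f ts) = Fun f (map (subst_uterm s) ts)"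

fun eval_uterm :: "('f, 'a) ualg \<Rightarrow> ('v \<Rightarrow> 'a) \<Rightarrow> ('f, 'v) uterm \<Rightarrow> 'a" where
  "eval_uterm A e (Var v) = e v"
| "eval_uterm A e (Fun f ts) = oper A f (map (eval_uterm A e) ts)"

definition satisfies :: "('f, 'a) ualg \<Rightarrow> ('f, 'v) uterm \<Rightarrow> ('f, 'v) uterm \<Rightarrow> bool" where
  "satisfies A s t \<longleftrightarrow> (\<forall>e. range e \<subseteq> universe A \<longrightarrow> eval_uterm A e s = eval_uterm A e t)"

text \<open>
  A variety is the class of all models of a set of identities.  The type \<open>'u\<close>, on which nothing is
  assumed, serves as the universe of discourse from which the elements of the algebras are drawn.
\<close>

definition variety :: "('f \<Rightarrow> nat) \<Rightarrow> ('f, 'u) ualg set \<Rightarrow> bool" where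
  "variety ar V \<longleftrightarrow> (\<exists>E :: (('f, nat) uterm \<times> ('f, nat) uterm) set.
     (\<forall>(s, t)\<in>E. wf_uterm ar s \<and> wf_uterm ar t) \<and>
     V = {A. algebra ar A \<and> (\<forall>(s, t)\<in>E. satisfies A s t)})"

datatype cube_var = X | Y

text \<open>
  The term \<open>t\<close> is \<open>m\<close>-ary in the variables \<open>0, \<dots>, m - 1\<close>.  Row \<open>i\<close> of the \<open>d \<times> m\<close> matrix \<open>M\<close>
  is the list of variables substituted in the \<open>i\<close>-th identity.
\<close>

definition cube_term ::
  "('f \<Rightarrow> nat) \<Rightarrow> ('f, 'u) ualg set \<Rightarrow> nat \<Rightarrow> ('f, nat) uterm \<Rightarrow> bool" where
  "cube_term ar V d t \<longleftrightarrow> wf_uterm ar t \<and>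
     (\<exists>m (M :: nat \<Rightarrow> nat \<Rightarrow> cube_var).
        vars_uterm t \<subseteq> {..<m} \<and>
        (\<forall>j<m. \<exists>i<d. M i j = X) \<and>
        (\<forall>A\<in>V. \<forall>i<d. satisfies A (subst_uterm (\<lambda>j. Var (M i j)) t) (Var Y)))"

lemma congruence_prod_rel:
  assumes "\<forall>i\<in>I. congruence ar (A i) (\<theta> i)"
  shows "congruence ar (prod_alg I A) (prod_rel I \<theta>)"
proof -
  have eq: "equiv (universe (A i)) (\<theta> i)" if "i \<in> I" for i
    using assms that by (simp add: congruence_def)
  have "equiv (universe (prod_alg I A)) (prod_rel I \<theta>)"
  proof (rule equivI)
    show "prod_rel I \<theta> \<subseteq> universe (prod_alg I A) \<times> universe (prod_alg I A)"
      using eq by (fastforce simp: prod_rel_def prod_alg_def PiE_iff equiv_def)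
    show "refl_on (universe (prod_alg I A)) (prod_rel I \<theta>)"
      using eq by (auto simp: prod_rel_def prod_alg_def PiE_iff equiv_def refl_on_def)
    show "sym (prod_rel I \<theta>)"
      using eq by (auto simp: prod_rel_def equiv_def sym_def)
    show "trans (prod_rel I \<theta>)"
      using eq by (auto simp: prod_rel_def equiv_def intro!: transI) (meson transD)
  qed
  moreover have "(oper (prod_alg I A) f xs, oper (prod_alg I A) f ys) \<in> prod_rel I \<theta>"
    if len: "length xs = ar f" and rel: "list_all2 (\<lambda>x y. (x, y) \<in> prod_rel I \<theta>) xs ys" for f xs ys
  proof -
    have "(oper (A i) f (map (\<lambda>x. x i) xs), oper (A i) f (map (\<lambda>x. x i) ys)) \<in> \<theta> i" if "i \<in> I" for i
    proof -
      have "list_all2 (\<lambda>x y. (x, y) \<in> \<theta> i) (map (\<lambda>x. x i) xs) (map (\<lambda>x. x i) ys)"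
        unfolding list.rel_map using rel
        by (rule list_all2_mono) (use that in \<open>auto simp: prod_rel_def\<close>)
      then show ?thesis
        using assms that len by (simp add: congruence_def)
    qed
    then show ?thesis
      by (simp add: prod_alg_def prod_rel_def)
  qed
  ultimately show ?thesis
    by (simp add: congruence_def)
qed

lemma subalgebra_saturation:
  assumes A: "algebra ar A" and B: "subalgebra ar B A" and \<theta>: "congruence ar A \<theta>"
  shows "subalgebra ar (saturation A \<theta> B) A"
    and "universe B \<subseteq> universe (saturation A \<theta> B)"
    and "\<theta> `` universe (saturation A \<theta> B) \<subseteq> universe (saturation A \<theta> B)"
    and "\<lbrakk>subalgebra ar C A; universe B \<subseteq> universe C; \<theta> `` universe C \<subseteq> universe C\<rbrakk>
      \<Longrightarrow> universe (saturation A \<theta> B) \<subseteq> universe C"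
proof -
  have eq: "equiv (universe A) \<theta>"
    using \<theta> by (simp add: congruence_def)
  have BA: "universe B \<subseteq> universe A" "universe B \<noteq> {}"
    using B by (auto simp: subalgebra_def algebra_def)
  show sub: "universe B \<subseteq> universe (saturation A \<theta> B)"
    using eq BA by (auto simp: saturation_def equiv_def refl_on_def)
  show "\<theta> `` universe (saturation A \<theta> B) \<subseteq> universe (saturation A \<theta> B)"
    using eq by (auto simp: saturation_def equiv_def) (meson transD)
  have "oper A f ys \<in> universe (saturation A \<theta> B)"
    if len: "length ys = ar f" and ys: "set ys \<subseteq> universe (saturation A \<theta> B)" for f ys
  proof -
    have "\<exists>g. \<forall>y\<in>set ys. g y \<in> universe B \<and> (g y, y) \<in> \<theta>"
      using ys by (intro bchoice) (auto simp: saturation_def)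
    then obtain g where g: "\<forall>y\<in>set ys. g y \<in> universe B \<and> (g y, y) \<in> \<theta>"
      by blast
    have "oper A f (map g ys) = oper B f (map g ys)" "oper B f (map g ys) \<in> universe B"
      using B g len by (auto simp: subalgebra_def algebra_def image_subset_iff)
    moreover have "list_all2 (\<lambda>x y. (x, y) \<in> \<theta>) (map g ys) ys"
      using g by (auto simp: list_all2_conv_all_nth)
    then have "(oper A f (map g ys), oper A f ys) \<in> \<theta>"
      using \<theta> len by (simp add: congruence_def)
    ultimately show ?thesis
      by (auto simp: saturation_def)
  qed
  moreover have "universe (saturation A \<theta> B) \<subseteq> universe A"
    using eq by (auto simp: saturation_def equiv_def)
  ultimately show "subalgebra ar (saturation A \<theta> B) A"
    using sub BA by (auto simp: subalgebra_def algebra_def saturation_def)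
  show "universe (saturation A \<theta> B) \<subseteq> universe C"
    if "subalgebra ar C A" "universe B \<subseteq> universe C" "\<theta> `` universe C \<subseteq> universe C"
    using that by (auto simp: saturation_def)
qed

end

theory Submission
  imports Defs
begin

text \<open>
  Let \<open>S\<close> be a subuniverse of \<open>B[\<theta>]\<close> containing \<open>G \<union> \<Lambda> \<union> \<Phi>\<close>, hence \<open>B\<close>, and let \<open>Q\<close> be the algebra of
  all pairs \<open>(b, c) \<in> \<theta>\<close> with \<open>b \<in> B\<close> and \<open>c \<in> S\<close>.  By induction on \<open>J \<subseteq> [n]\<close>, every \<open>\<theta>\<close>-related pair
  in \<open>B \<times> B[\<theta>]\<close> agrees on \<open>J\<close> with a member of \<open>Q\<close>; for \<open>J = [n]\<close> this is the claim.  If \<open>|J| < d\<close>, use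
  condition (1).  Otherwise the induction hypothesis gives a member of \<open>Q\<close> that is correct off
  \<open>l = max J\<close>, and its value at \<open>l\<close> is corrected along forks: those of condition (2), and those formed
  by two elements of \<open>B\<close> that agree on \<open>J - {l}\<close>.  That a fork may be used in this way, given
  members of \<open>Q\<close> which are correct off each of \<open>d - 1\<close> blocks partitioning \<open>J - {l}\<close>, is the
  \<open>(1, d - 1)\<close>-parallelogram property.  It is iterated from an edge term, which in turn is
  obtained from the cube term by nested substitutions that discard columns of the matrix.
\<close>

section \<open>Evaluation of terms: substitution, subuniverses, congruences, products\<close>

lemma eval_uterm_cong:
  "(\<And>v. v \<in> vars_uterm t \<Longrightarrow> e v = e' v) \<Longrightarrow> eval_uterm A e t = eval_uterm A e' t"
proof (induction t)
  case (Fun f ts)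
  then have "map (eval_uterm A e) ts = map (eval_uterm A e') ts"
    by auto
  then show ?case by (metis eval_uterm.simps(2))
qed simp

lemma eval_subst_uterm:
  "eval_uterm A e (subst_uterm s t) = eval_uterm A (\<lambda>v. eval_uterm A e (s v)) t"
proof (induction t)
  case (Fun f ts)
  then have "map (\<lambda>u. eval_uterm A e (subst_uterm s u)) ts =
      map (eval_uterm A (\<lambda>v. eval_uterm A e (s v))) ts"
    by auto
  then show ?case by (simp add: o_def del: map_eq_conv)
qed simp

lemma wf_subst_uterm:
  "wf_uterm ar t \<Longrightarrow> (\<And>v. v \<in> vars_uterm t \<Longrightarrow> wf_uterm ar (s v)) \<Longrightarrow> wf_uterm ar (subst_uterm s t)"
  by (induction t) auto

lemma vars_subst_uterm: "vars_uterm (subst_uterm s t) = (\<Union>v\<in>vars_uterm t. vars_uterm (s v))"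
  by (induction t) auto

lemma eval_uterm_in_subuniverse:
  "wf_uterm ar t \<Longrightarrow> subuniverse ar A S \<Longrightarrow> (\<And>v. v \<in> vars_uterm t \<Longrightarrow> e v \<in> S)
    \<Longrightarrow> eval_uterm A e t \<in> S"
proof (induction t)
  case (Fun f ts)
  then have "set (map (eval_uterm A e) ts) \<subseteq> S" by auto
  moreover have "length (map (eval_uterm A e) ts) = ar f" using Fun.prems by simp
  ultimately show ?case using Fun.prems(2) unfolding subuniverse_def eval_uterm.simps by blast
qed simp

lemma eval_uterm_congruence:
  "wf_uterm ar t \<Longrightarrow> congruence ar A \<theta> \<Longrightarrow> (\<And>v. v \<in> vars_uterm t \<Longrightarrow> (e v, e' v) \<in> \<theta>)
    \<Longrightarrow> (eval_uterm A e t, eval_uterm A e' t) \<in> \<theta>"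
proof (induction t)
  case (Fun f ts)
  then have "list_all2 (\<lambda>x y. (x, y) \<in> \<theta>) (map (eval_uterm A e) ts) (map (eval_uterm A e') ts)"
    unfolding list.rel_map by (intro list.rel_refl_strong) auto
  then show ?case using Fun.prems by (simp add: congruence_def)
qed simp

lemma eval_uterm_prod_alg:
  assumes "i \<in> I"
  shows "eval_uterm (prod_alg I A) e t i = eval_uterm (A i) (\<lambda>v. e v i) t"
proof (induction t)
  case (Fun f ts)
  then have "map (\<lambda>u. eval_uterm (prod_alg I A) e u i) ts = map (eval_uterm (A i) (\<lambda>v. e v i)) ts"
    by auto
  moreover have "eval_uterm (prod_alg I A) e (Fun f ts) i =
      oper (A i) f (map (\<lambda>u. eval_uterm (prod_alg I A) e u i) ts)"
    using assms by (simp add: prod_alg_def o_def)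
  ultimately show ?case by (simp del: map_eq_conv eval_uterm.simps) simp
qed simp

lemma subuniverse_universe: "algebra ar A \<Longrightarrow> subuniverse ar A (universe A)"
  by (auto simp: algebra_def subuniverse_def)

section \<open>Cube terms with variables indexed by columns, and their composition\<close>

text \<open>
  A variable \<open>N\<close> of the term stands for the column of the cube matrix whose entries \<open>x\<close> are in the
  rows \<open>k \<in> N\<close>.
\<close>

definition cube_family ::
  "('f \<Rightarrow> nat) \<Rightarrow> ('f, 'u) ualg set \<Rightarrow> nat \<Rightarrow> nat set set \<Rightarrow> ('f, nat set) uterm \<Rightarrow> bool" where
  "cube_family ar V d \<N> t \<longleftrightarrow> wf_uterm ar t \<and> vars_uterm t \<subseteq> \<N> \<and>
     (\<forall>A\<in>V. \<forall>k<d. \<forall>x\<in>universe A. \<forall>y\<in>universe A.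
        eval_uterm A (\<lambda>N. if k \<in> N then x else y) t = y)"

lemma cube_family_of_cube_term:
  assumes "cube_term ar V d t"
  shows "\<exists>t'. cube_family ar V d {N. N \<noteq> {} \<and> N \<subseteq> {..<d}} t'"
proof -
  obtain m M where wf: "wf_uterm ar t" and vars: "vars_uterm t \<subseteq> {..<m}"
    and col: "\<forall>j<m. \<exists>i<d. M i j = X"
    and sat: "\<forall>A\<in>V. \<forall>i<d. satisfies A (subst_uterm (\<lambda>j. Var (M i j)) t) (Var Y)"
    using assms unfolding cube_term_def by auto
  \<comment> \<open>Only the set of rows holding \<open>X\<close> matters to the identities, so
    variables with equal columns are identified.\<close>
  define c where "c = (\<lambda>j. {i. i < d \<and> M i j = X})"
  let ?t = "subst_uterm (\<lambda>j. Var (c j)) t"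
  have "wf_uterm ar ?t"
    using wf by (intro wf_subst_uterm) auto
  moreover have "vars_uterm ?t \<subseteq> {N. N \<noteq> {} \<and> N \<subseteq> {..<d}}"
    using vars col by (fastforce simp: vars_subst_uterm c_def)
  moreover have "eval_uterm A (\<lambda>N. if k \<in> N then x else y) ?t = y"
    if A: "A \<in> V" and k: "k < d" and x: "x \<in> universe A" and y: "y \<in> universe A" for A k x y
  proof -
    let ?e = "\<lambda>v. case v of X \<Rightarrow> x | Y \<Rightarrow> y"
    have "range ?e \<subseteq> universe A"
      using x y by (auto split: cube_var.splits)
    then have "eval_uterm A ?e (subst_uterm (\<lambda>j. Var (M k j)) t) = eval_uterm A ?e (Var Y)"
      using sat A k unfolding satisfies_def by blast
    moreover have "eval_uterm A (\<lambda>j. ?e (M k j)) t = eval_uterm A (\<lambda>j. if k \<in> c j then x else y) t"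
      by (rule eval_uterm_cong) (use k in \<open>auto simp: c_def split: cube_var.splits\<close>)
    ultimately show ?thesis by (simp add: eval_subst_uterm)
  qed
  ultimately show ?thesis unfolding cube_family_def by blast
qed

text \<open>
  Substituting into the variable \<open>N\<close> of the outer term the inner term evaluated at the columns
  \<open>base N c\<close>: row \<open>r\<close> of the result is \<open>y\<close> when \<open>r \<notin> N\<close>, and otherwise an element not depending
  on \<open>N\<close>, which takes over the role of \<open>x\<close> in the outer identity.
\<close>

lemma cube_family_compose:
  assumes alg: "\<And>A. A \<in> V \<Longrightarrow> algebra ar A"
    and outer: "cube_family ar V d \<N>\<^sub>o t" and inner: "cube_family ar V d \<N>\<^sub>i u"
    and base: "\<And>N c. N \<in> \<N>\<^sub>o \<Longrightarrow> c \<in> \<N>\<^sub>i \<Longrightarrow> base N c \<in> \<N>"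
    and row_in: "\<And>r. r < d \<Longrightarrow> \<exists>K. \<forall>N\<in>\<N>\<^sub>o. r \<in> N \<longrightarrow> (\<forall>c\<in>\<N>\<^sub>i. r \<in> base N c \<longleftrightarrow> c \<in> K)"
    and row_out: "\<And>r N. r < d \<Longrightarrow> N \<in> \<N>\<^sub>o \<Longrightarrow> r \<notin> N \<Longrightarrow>
      (\<forall>c\<in>\<N>\<^sub>i. r \<notin> base N c) \<or> (\<exists>k<d. \<forall>c\<in>\<N>\<^sub>i. r \<in> base N c \<longleftrightarrow> k \<in> c)"
  shows "\<exists>t'. cube_family ar V d \<N> t'"
proof -
  let ?t = "subst_uterm (\<lambda>N. subst_uterm (\<lambda>c. Var (base N c)) u) t"
  have t: "wf_uterm ar t" "vars_uterm t \<subseteq> \<N>\<^sub>o" and u: "wf_uterm ar u" "vars_uterm u \<subseteq> \<N>\<^sub>i"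
    using outer inner by (auto simp: cube_family_def)
  have "wf_uterm ar ?t"
    using t u by (intro wf_subst_uterm) auto
  moreover have "vars_uterm ?t \<subseteq> \<N>"
    using t u base by (fastforce simp: vars_subst_uterm)
  moreover have "eval_uterm A (\<lambda>N. if r \<in> N then x else y) ?t = y"
    if A: "A \<in> V" and r: "r < d" and x: "x \<in> universe A" and y: "y \<in> universe A" for A r x y
  proof -
    obtain K where K: "\<forall>N\<in>\<N>\<^sub>o. r \<in> N \<longrightarrow> (\<forall>c\<in>\<N>\<^sub>i. r \<in> base N c \<longleftrightarrow> c \<in> K)"
      using row_in r by blast
    define x' where "x' = eval_uterm A (\<lambda>c. if c \<in> K then x else y) u"
    have x': "x' \<in> universe A"
      unfolding x'_def using u subuniverse_universe[OF alg[OF A]] x y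
      by (intro eval_uterm_in_subuniverse) auto
    have inner_y: "eval_uterm A (\<lambda>c. if k \<in> c then z else y) u = y"
      if "k < d" "z \<in> universe A" for k z
      using inner A y that unfolding cube_family_def by blast
    have "eval_uterm A (\<lambda>c. if r \<in> base N c then x else y) u = (if r \<in> N then x' else y)"
      if N: "N \<in> vars_uterm t" for N
    proof (cases "r \<in> N")
      case True
      then have "\<forall>c\<in>\<N>\<^sub>i. r \<in> base N c \<longleftrightarrow> c \<in> K" using K N t by blast
      then have "eval_uterm A (\<lambda>c. if r \<in> base N c then x else y) u = x'"
        unfolding x'_def using u by (intro eval_uterm_cong) auto
      then show ?thesis using True by simp
    next
      case False
      from N t have "N \<in> \<N>\<^sub>o" by blast
      from row_out[OF r this False] show ?thesis
      proof
        assume *: "\<forall>c\<in>\<N>\<^sub>i. r \<notin> base N c"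
        \<comment> \<open>All arguments are \<open>y\<close>; the identity of row \<open>r\<close>
          with \<open>y\<close> for \<open>x\<close> as well shows that the inner term is
          idempotent.\<close>
        have "eval_uterm A (\<lambda>c. if r \<in> base N c then x else y) u =
            eval_uterm A (\<lambda>c. if r \<in> c then y else y) u"
          using * u by (intro eval_uterm_cong) auto
        then show ?thesis using inner_y[OF r y] False by simp
      next
        assume "\<exists>k<d. \<forall>c\<in>\<N>\<^sub>i. r \<in> base N c \<longleftrightarrow> k \<in> c"
        then obtain k where k: "k < d" "\<forall>c\<in>\<N>\<^sub>i. r \<in> base N c \<longleftrightarrow> k \<in> c" by blast
        have "eval_uterm A (\<lambda>c. if r \<in> base N c then x else y) u =
            eval_uterm A (\<lambda>c. if k \<in> c then x else y) u"
          using k u by (intro eval_uterm_cong) auto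
        then show ?thesis using inner_y[OF k(1) x] False by simp
      qed
    qed
    then have "eval_uterm A (\<lambda>N. if r \<in> N then x else y) ?t =
        eval_uterm A (\<lambda>N. if r \<in> N then x' else y) t"
      by (simp add: eval_subst_uterm) (rule eval_uterm_cong, simp)
    also have "\<dots> = y"
      using outer A r x' y unfolding cube_family_def by blast
    finally show ?thesis .
  qed
  ultimately show ?thesis unfolding cube_family_def by blast
qed

section \<open>Discarding columns until an edge term remains\<close>

text \<open>An interpolation: for \<open>S = {..<d}\<close> these are all columns of a cube term,
  for \<open>S = {0, 1}\<close> the \<open>d + 1\<close> columns of an edge term.\<close>

definition mixes :: "nat \<Rightarrow> nat set \<Rightarrow> nat set set" where
  "mixes d S = {N. N \<noteq> {} \<and> N \<subseteq> S} \<union> (\<lambda>k. {k}) ` {..<d}"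

text \<open>
  The substitution for a distinguished row \<open>s \<in> S\<close>: the new \<open>x\<close> of row \<open>s\<close> is the inner term with the old
  \<open>x\<close> in column \<open>{s}\<close> only, and that of the other rows in \<open>S\<close> has the old \<open>x\<close> in the columns
  \<open>c \<subseteq> S\<close> other than \<open>{s}\<close>.
\<close>

definition base_column :: "nat set \<Rightarrow> nat \<Rightarrow> nat set \<Rightarrow> nat set \<Rightarrow> nat set" where
  "base_column S s N c =
    (if \<not> N \<subseteq> S then N
     else if \<not> c \<subseteq> S then c
     else if s \<in> N then (if c = {s} then {s} else (N \<union> c) - {s})
     else if N = S - {s} then (if c = {s} then {s} else if s \<in> c then S else N)
     else let i = (SOME i. i \<in> S - N - {s})
       in if c = {s} then {i} else if s \<in> c then insert i N else N)"

lemma some_in_rest: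
  assumes "N \<subseteq> S" "s \<notin> N" "N \<noteq> S - {s}"
  shows "(SOME i. i \<in> S - N - {s}) \<in> S - N - {s}"
  using assms by (intro someI_ex[of "\<lambda>i. i \<in> S - N - {s}"]) blast

lemma mixes_not_subset:
  "N \<in> mixes d S \<Longrightarrow> \<not> N \<subseteq> S \<Longrightarrow> \<exists>k<d. k \<notin> S \<and> N = {k}"
  by (auto simp: mixes_def)

lemma mixes_nonempty: "N \<in> mixes d S \<Longrightarrow> N \<noteq> {}"
  by (auto simp: mixes_def)

text \<open>A row outside \<open>S\<close> meets only \<open>N = {r}\<close>, which is kept whatever
  \<open>c\<close> is. Within \<open>S\<close>, membership of \<open>r\<close> in the new column is
  decided by \<open>c\<close> alone: \<open>{s}\<close> separates row \<open>s\<close> from the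
  others, and a \<open>c\<close> outside \<open>S\<close> is a singleton missing
  \<open>r\<close>.\<close>

lemma base_column_row_in:
  assumes s: "s \<in> S"
  shows "\<exists>K. \<forall>N\<in>mixes d S. r \<in> N \<longrightarrow> (\<forall>c\<in>mixes d S. r \<in> base_column S s N c \<longleftrightarrow> c \<in> K)"
proof -
  define K where "K = (if r \<notin> S then UNIV else if r = s then {{s}} else {c. c \<subseteq> S \<and> c \<noteq> {s}})"
  have "r \<in> base_column S s N c \<longleftrightarrow> c \<in> K"
    if N: "N \<in> mixes d S" and rN: "r \<in> N" and c: "c \<in> mixes d S" for N c
  proof (cases "N \<subseteq> S")
    case False
    then show ?thesis using mixes_not_subset[OF N] rN by (auto simp: base_column_def K_def)
  next
    case NS: True
    then have rS: "r \<in> S" using rN by blast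
    show ?thesis
    proof (cases "c \<subseteq> S")
      case False
      then show ?thesis using mixes_not_subset[OF c] NS rS s by (auto simp: base_column_def K_def)
    next
      case cS: True
      show ?thesis
      proof (cases "s \<in> N \<or> N = S - {s}")
        case True
        then show ?thesis using NS cS rS rN s by (auto simp: base_column_def K_def)
      next
        case False
        then have "(SOME i. i \<in> S - N - {s}) \<in> S - N - {s}"
          using NS by (intro some_in_rest) auto
        then show ?thesis using False NS cS rS rN s
          by (auto simp: base_column_def K_def Let_def)
      qed
    qed
  qed
  then show ?thesis by blast
qed

text \<open>Let \<open>N\<close> lie inside \<open>S\<close>. If \<open>s\<close> is in
  \<open>N\<close> or \<open>N = S - {s}\<close>, the new column contains \<open>r\<close> exactly
  when \<open>c\<close> does, so the inner identity of row \<open>r\<close> applies. Otherwise the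
  auxiliary row \<open>i\<close> copies row \<open>s\<close> of the inner identities, the other rows
  of \<open>S\<close> outside \<open>N\<close> get \<open>y\<close> throughout, and rows outside
  \<open>S\<close> keep their own identity.\<close>

lemma base_column_row_out:
  assumes s: "s \<in> S" and S: "S \<subseteq> {..<d}" and r: "r < d"
    and N: "N \<in> mixes d S" and rN: "r \<notin> N"
  shows "(\<forall>c\<in>mixes d S. r \<notin> base_column S s N c) \<or>
    (\<exists>k<d. \<forall>c\<in>mixes d S. r \<in> base_column S s N c \<longleftrightarrow> k \<in> c)"
proof -
  have sd: "s < d" using s S by blast
  consider "\<not> N \<subseteq> S" | "N \<subseteq> S" "s \<in> N \<or> N = S - {s}" | "N \<subseteq> S" "s \<notin> N" "N \<noteq> S - {s}"
    by blast
  then show ?thesis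
  proof cases
    case 1
    then show ?thesis using rN by (simp add: base_column_def)
  next
    case 2
    have "r \<in> base_column S s N c \<longleftrightarrow> r \<in> c" if "c \<in> mixes d S" for c
      using 2 mixes_nonempty[OF that] s rN by (auto simp: base_column_def)
    then show ?thesis using r by blast
  next
    case 3
    define i where "i = (SOME i. i \<in> S - N - {s})"
    have i: "i \<in> S - N - {s}"
      unfolding i_def by (rule some_in_rest) (use 3 in auto)
    have eq: "base_column S s N c = (if \<not> c \<subseteq> S then c else if c = {s} then {i} else
        if s \<in> c then insert i N else N)" for c
      using 3 by (simp add: base_column_def i_def Let_def)
    have out: "s \<notin> c" "i \<notin> c" if "c \<in> mixes d S" "\<not> c \<subseteq> S" for c
      using mixes_not_subset[OF that] s i by auto
    show ?thesis
    proof (cases "r \<in> S")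
      case True
      show ?thesis
      proof (cases "r = i")
        case True
        have "r \<in> base_column S s N c \<longleftrightarrow> s \<in> c" if "c \<in> mixes d S" for c
          using out[OF that] rN i True by (auto simp: eq)
        then show ?thesis using sd by blast
      next
        case False
        have "r \<notin> base_column S s N c" if "c \<in> mixes d S" for c
          using mixes_not_subset[OF that] rN False \<open>r \<in> S\<close> by (auto simp: eq)
        then show ?thesis by blast
      qed
    next
      case False
      have "r \<in> base_column S s N c \<longleftrightarrow> r \<in> c" if "c \<in> mixes d S" for c
        using False i 3 by (auto simp: eq)
      then show ?thesis using r by blast
    qed
  qed
qed

text \<open>\<open>S - {j}\<close> contains \<open>s\<close> and a further element \<open>k\<close>,
  whereas every column produced is a singleton, all of \<open>S\<close>, or a set without
  \<open>s\<close>.\<close>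

lemma base_column_mixes_minus:
  assumes s: "s \<in> S" and S: "S \<subseteq> {..<d}" and j: "j \<in> S" "j \<noteq> s"
    and two: "k \<in> S" "k \<noteq> s" "k \<noteq> j"
    and N: "N \<in> mixes d S" and c: "c \<in> mixes d S"
  shows "base_column S s N c \<in> mixes d S - {S - {j}}"
proof -
  have single: "{i} \<in> mixes d S - {S - {j}}" if "i < d" for i
  proof -
    have "S - {j} \<noteq> {i}"
    proof
      assume "S - {j} = {i}"
      moreover have "s \<in> S - {j}" "k \<in> S - {j}" using s j two by blast+
      ultimately show False using two by simp
    qed
    then show ?thesis using that by (auto simp: mixes_def)
  qed
  consider "\<not> N \<subseteq> S" | "N \<subseteq> S" "\<not> c \<subseteq> S" | "N \<subseteq> S" "c \<subseteq> S" "s \<in> N \<or> N = S - {s}"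
    | "N \<subseteq> S" "c \<subseteq> S" "s \<notin> N" "N \<noteq> S - {s}"
    by blast
  then show ?thesis
  proof cases
    case 1
    then show ?thesis using mixes_not_subset[OF N] single by (auto simp: base_column_def)
  next
    case 2
    then show ?thesis using mixes_not_subset[OF c] single by (auto simp: base_column_def)
  next
    case 3
    show ?thesis
    proof (cases "c = {s}")
      case True
      then show ?thesis using single[of s] 3 s S by (auto simp: base_column_def)
    next
      case False
      have "base_column S s N c \<noteq> {}" "base_column S s N c \<subseteq> S"
        using 3 False mixes_nonempty[OF c] mixes_nonempty[OF N] s
        by (auto simp: base_column_def)
      moreover have "base_column S s N c \<noteq> S - {j}"
        using 3 False s j by (auto simp: base_column_def)
      ultimately show ?thesis by (auto simp: mixes_def)
    qed
  next
    case 4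
    define i where "i = (SOME i. i \<in> S - N - {s})"
    have i: "i \<in> S - N - {s}"
      unfolding i_def by (rule some_in_rest) (use 4 in auto)
    have eq: "base_column S s N c = (if c = {s} then {i} else if s \<in> c then insert i N else N)"
      using 4 by (simp add: base_column_def i_def Let_def)
    show ?thesis
    proof (cases "c = {s}")
      case True
      have "i < d" using i S by blast
      then show ?thesis using True single[of i] unfolding eq by simp
    next
      case False
      have "base_column S s N c \<noteq> {}" "base_column S s N c \<subseteq> S"
        using 4 False i mixes_nonempty[OF N] by (auto simp: eq)
      moreover have "s \<notin> base_column S s N c" using 4 False i by (auto simp: eq)
      ultimately show ?thesis using s j by (auto simp: mixes_def)
    qed
  qed
qed

text \<open>With special row \<open>j\<close>, only the branch \<open>N = S\<close> could return a
  column containing \<open>j\<close> properly, and that \<open>N\<close> is excluded. All other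
  results are singletons or nonempty subsets of \<open>S\<close>.\<close>

lemma base_column_mixes_smaller:
  assumes j: "j \<notin> S" "j < d" and S: "S \<subseteq> {..<d}"
    and N: "N \<in> mixes d (insert j S) - {S}" and c: "c \<in> mixes d (insert j S)"
  shows "base_column (insert j S) j N c \<in> mixes d S"
proof -
  let ?S = "insert j S"
  have single: "{i} \<in> mixes d S" if "i < d" for i
    using that by (auto simp: mixes_def)
  have eS: "?S - {j} = S" using j by blast
  consider "\<not> N \<subseteq> ?S" | "N \<subseteq> ?S" "\<not> c \<subseteq> ?S" | "N \<subseteq> ?S" "c \<subseteq> ?S" "j \<in> N"
    | "N \<subseteq> ?S" "c \<subseteq> ?S" "j \<notin> N"
    by blast
  then show ?thesis
  proof cases
    case 1
    then show ?thesis using mixes_not_subset[of N d ?S] N single by (auto simp: base_column_def)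
  next
    case 2
    then show ?thesis using mixes_not_subset[OF c] single by (auto simp: base_column_def)
  next
    case 3
    show ?thesis
    proof (cases "c = {j}")
      case True
      then show ?thesis using single[of j] 3 j by (auto simp: base_column_def)
    next
      case False
      have "(N \<union> c) - {j} \<noteq> {}" using False mixes_nonempty[OF c] by blast
      moreover have "(N \<union> c) - {j} \<subseteq> S" using 3 by blast
      ultimately show ?thesis using 3 False by (simp add: base_column_def mixes_def)
    qed
  next
    case 4
    define i where "i = (SOME i. i \<in> ?S - N - {j})"
    have i: "i \<in> ?S - N - {j}"
      unfolding i_def by (rule some_in_rest) (use 4 N eS in auto)
    have eq: "base_column ?S j N c = (if c = {j} then {i} else if j \<in> c then insert i N else N)"
      using 4 N eS by (simp add: base_column_def i_def Let_def)
    have "N \<noteq> {}" "N \<subseteq> S" using N 4 mixes_nonempty[of N d ?S] by blast+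
    then show ?thesis using i single[of i] S by (auto simp: eq mixes_def)
  qed
qed

text \<open>
  Passing from \<open>insert j S\<close> to \<open>S\<close> takes two compositions: the first removes only the column \<open>S\<close>,
  the second, with special row \<open>j\<close>, removes the other columns that contain \<open>j\<close> properly.
\<close>

lemma cube_family_mixes_step:
  assumes alg: "\<And>A. A \<in> V \<Longrightarrow> algebra ar A"
    and t: "cube_family ar V d (mixes d (insert j S)) t"
    and j: "j \<notin> S" "j < d" and S: "S \<subseteq> {..<d}" and s: "s \<in> S" and k: "k \<in> S" "k \<noteq> s"
  shows "\<exists>t'. cube_family ar V d (mixes d S) t'"
proof -
  let ?S = "insert j S"
  have S': "?S \<subseteq> {..<d}" using j S by blast
  have eS: "?S - {j} = S" using j by blast
  have "\<exists>t'. cube_family ar V d (mixes d ?S - {?S - {j}}) t'"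
    by (rule cube_family_compose[OF alg t t, where base = "base_column ?S s"])
      (use base_column_mixes_minus[of s ?S d j k] base_column_row_in[of s ?S d]
        base_column_row_out[of s ?S d] S' s k j in auto)
  then obtain u where u: "cube_family ar V d (mixes d ?S - {S}) u" unfolding eS by blast
  \<comment> \<open>Only the outer term must avoid the column \<open>S\<close>; the inner one may be
    the original \<open>t\<close>.\<close>
  show ?thesis
  proof (rule cube_family_compose[OF alg u t, where base = "base_column ?S j"])
    show "base_column ?S j N c \<in> mixes d S"
      if "N \<in> mixes d ?S - {S}" "c \<in> mixes d ?S" for N c
      using base_column_mixes_smaller j S that by blast
    show "\<exists>K. \<forall>N\<in>mixes d ?S - {S}. r \<in> N \<longrightarrow>
        (\<forall>c\<in>mixes d ?S. r \<in> base_column ?S j N c \<longleftrightarrow> c \<in> K)" for r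
      using base_column_row_in[of j ?S d r] by blast
    show "(\<forall>c\<in>mixes d ?S. r \<notin> base_column ?S j N c) \<or>
        (\<exists>k<d. \<forall>c\<in>mixes d ?S. r \<in> base_column ?S j N c \<longleftrightarrow> k \<in> c)"
      if "r < d" "N \<in> mixes d ?S - {S}" "r \<notin> N" for r N
      using base_column_row_out[of j ?S d r N] S' that by blast
  qed auto
qed

text \<open>Rows leave the block \<open>{..<m}\<close> one at a time from the top, with rows 0 and 1
  as \<open>s\<close> and \<open>k\<close>. This stops at \<open>{0, 1}\<close> because the step
  needs two rows to remain.\<close>

lemma cube_family_edge:
  assumes alg: "\<And>A. A \<in> V \<Longrightarrow> algebra ar A" and t: "cube_term ar V d t" and d: "d > 1"
  shows "\<exists>u. cube_family ar V d (mixes d {0, 1}) u"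
proof -
  have "{N. N \<noteq> {} \<and> N \<subseteq> {..<d}} = mixes d {..<d}" by (auto simp: mixes_def)
  then have top: "\<exists>u. cube_family ar V d (mixes d {..<d}) u"
    using cube_family_of_cube_term[OF t] by simp
  have "\<exists>u. cube_family ar V d (mixes d {..<m}) u" if "m \<le> d" "2 \<le> m" for m
    using that
  proof (induction rule: inc_induct)
    case base
    show ?case by (rule top)
  next
    case (step i)
    then obtain u where "cube_family ar V d (mixes d (insert i {..<i})) u"
      by (auto simp: lessThan_Suc)
    from cube_family_mixes_step[OF alg this, of 0 1] show ?case using step by auto
  qed
  moreover have "{..<2} = {0, 1::nat}" by auto
  ultimately show ?thesis using d by (metis One_nat_def Suc_leI numeral_2_eq_2 order_refl)
qed

section \<open>Correcting a tuple along a fork by an edge term\<close>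

lemma mixes_01_cases:
  assumes "N \<in> mixes d {0, 1}"
  obtains "N = {0, 1}" | "N = {0}" | "N = {1}" | k where "2 \<le> k" "k < d" "N = {k}"
proof -
  consider "N \<noteq> {}" "N \<subseteq> {0, 1}" | k where "k < d" "N = {k}"
    using assms unfolding mixes_def by blast
  then show thesis
  proof cases
    case 1
    then have "N = {0, 1} \<or> N = {0} \<or> N = {1}" by blast
    then show thesis using that(1-3) by blast
  next
    case 2
    consider "k = 0" | "k = 1" | "2 \<le> k" by linarith
    then show thesis using 2 that(2-4) by cases auto
  qed
qed

text \<open>
  Each pass of the induction replaces the fork \<open>b, c\<close> by one that agrees with the target \<open>y\<close> on one
  more block: the block plays the role of row 1 of the edge identities, and the blocks on which
  agreement was reached before are protected by the elements \<open>e k\<close>.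
\<close>

lemma edge_exchange:
  fixes \<pi> :: "'i \<Rightarrow> 'r \<Rightarrow> 'a" and F :: "'i \<Rightarrow> (nat set \<Rightarrow> 'a) \<Rightarrow> 'a"
  assumes closed: "\<And>w. (\<And>N. w N \<in> R) \<Longrightarrow> \<exists>r\<in>R. \<forall>i\<in>D. \<pi> i r = F i (\<lambda>N. \<pi> i (w N))"
    and cong: "\<And>i f g. i \<in> D \<Longrightarrow> (\<And>N. N \<in> mixes d {0, 1} \<Longrightarrow> f N = g N) \<Longrightarrow> F i f = F i g"
    and ident: "\<And>i k u v. i \<in> D \<Longrightarrow> k < d \<Longrightarrow> u \<in> car i \<Longrightarrow> v \<in> car i \<Longrightarrow>
      F i (\<lambda>N. if k \<in> N then u else v) = v"
    and mem: "\<And>i r. i \<in> D \<Longrightarrow> r \<in> R \<Longrightarrow> \<pi> i r \<in> car i" and y: "\<And>i. i \<in> D \<Longrightarrow> y i \<in> car i"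
    and d: "d > 1" and blk: "\<And>i. i \<in> D \<Longrightarrow> blk i < d"
    and e: "\<And>k. 1 \<le> k \<Longrightarrow> k < d \<Longrightarrow> \<exists>r\<in>R. \<forall>i\<in>D. blk i \<noteq> k \<longrightarrow> \<pi> i r = y i"
    and R: "a \<in> R" "b \<in> R" "c \<in> R"
    and row0: "\<And>i. i \<in> D \<Longrightarrow> blk i = 0 \<Longrightarrow> \<pi> i a = \<pi> i b \<and> \<pi> i c = y i"
    and rest: "\<And>i. i \<in> D \<Longrightarrow> blk i \<noteq> 0 \<Longrightarrow> \<pi> i a = y i \<and> \<pi> i b = \<pi> i c"
  shows "\<exists>r\<in>R. \<forall>i\<in>D. \<pi> i r = y i"
proof -
  have "\<exists>e. \<forall>k\<in>{1..<d}. e k \<in> R \<and> (\<forall>i\<in>D. blk i \<noteq> k \<longrightarrow> \<pi> i (e k) = y i)"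
    by (rule bchoice) (use e in fastforce)
  then obtain e0 where e0: "\<forall>k\<in>{1..<d}. e0 k \<in> R \<and> (\<forall>i\<in>D. blk i \<noteq> k \<longrightarrow> \<pi> i (e0 k) = y i)" ..
  \<comment> \<open>The default \<open>a\<close> keeps \<open>e k\<close> in \<open>R\<close> for
    every \<open>k\<close>.\<close>
  define e where "e = (\<lambda>k. if k \<in> {1..<d} then e0 k else a)"
  have eR: "e k \<in> R" for k using e0 R by (simp add: e_def)
  have ey: "\<pi> i (e k) = y i" if "1 \<le> k" "k < d" "i \<in> D" "blk i \<noteq> k" for i k
    using e0 that by (simp add: e_def)
  have identI: "F i f = v"
    if "i \<in> D" "k < d" "u \<in> car i" "v \<in> car i"
      "\<And>N. N \<in> mixes d {0, 1} \<Longrightarrow> f N = (if k \<in> N then u else v)" for i k u v f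
    using cong[OF that(1,5)] ident[OF that(1-4)] by simp
  \<comment> \<open>The last clause records the blocks already repaired in \<open>c\<close>:
    \<open>P 1\<close> is the hypothesis, and \<open>P d\<close> makes \<open>c\<close> equal to
    \<open>y\<close> on all of \<open>D\<close>.\<close>
  define P where "P = (\<lambda>m a b c. a \<in> R \<and> b \<in> R \<and> c \<in> R \<and>
    (\<forall>i\<in>D. blk i = 0 \<longrightarrow> \<pi> i a = \<pi> i b \<and> \<pi> i c = y i) \<and>
    (\<forall>i\<in>D. blk i \<noteq> 0 \<longrightarrow> \<pi> i a = y i \<and> \<pi> i b = \<pi> i c) \<and>
    (\<forall>i\<in>D. 0 < blk i \<and> blk i < m \<longrightarrow> \<pi> i c = y i))"
  have "\<exists>a b c. P m a b c" if "1 \<le> m" "m \<le> d" for m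
    using that
  proof (induction m rule: nat_induct_at_least)
    case base
    have "P 1 a b c" using R row0 rest by (auto simp: P_def)
    then show ?case by blast
  next
    case (Suc m)
    then obtain a b c where abc: "P m a b c" by auto
    \<comment> \<open>This transposition lets block \<open>m\<close> use row 1 of the edge
      identities and block 1 use row \<open>m\<close>.\<close>
    define \<tau> where "\<tau> = (\<lambda>k::nat. if k = 1 then m else if k = m then 1 else k)"
    have \<tau>: "1 \<le> \<tau> k" "\<tau> k < d" "\<tau> k \<noteq> m" if "2 \<le> k" "k < d" for k
      using that Suc d by (auto simp: \<tau>_def)
    have \<tau>\<tau>: "\<tau> (\<tau> k) = k" for k by (auto simp: \<tau>_def)
    define w where "w = (\<lambda>\<alpha> \<beta> \<gamma> N. if N = {0, 1::nat} then \<alpha> else if N = {0} then \<beta>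
      else if N = {1} then \<gamma> else e (\<tau> (the_elem N)))"
    have w_simps: "w \<alpha> \<beta> \<gamma> {0, Suc 0} = \<alpha>" "w \<alpha> \<beta> \<gamma> {0} = \<beta>" "w \<alpha> \<beta> \<gamma> {Suc 0} = \<gamma>"
      "2 \<le> k \<Longrightarrow> w \<alpha> \<beta> \<gamma> {k} = e (\<tau> k)" for \<alpha> \<beta> \<gamma> k
      by (auto simp: w_def doubleton_eq_iff)
    have w_closed: "\<exists>r\<in>R. \<forall>i\<in>D. \<pi> i r = F i (\<lambda>N. \<pi> i (w \<alpha> \<beta> \<gamma> N))"
      if "\<alpha> \<in> R" "\<beta> \<in> R" "\<gamma> \<in> R" for \<alpha> \<beta> \<gamma>
      by (rule closed) (use that eR in \<open>auto simp: w_def\<close>)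
    have abcR: "a \<in> R" "b \<in> R" "c \<in> R" using abc by (auto simp: P_def)
    \<comment> \<open>On block 0, \<open>a = b\<close> equates \<open>a'\<close> with
      \<open>b'\<close>, and in \<open>(b, a, c)\<close> the columns containing 0 carry
      \<open>b\<close> against \<open>y\<close> elsewhere. Off block 0, \<open>b = c\<close> equates
      \<open>b'\<close> with \<open>c'\<close>. On block \<open>m\<close>, the columns of
      \<open>(b, a, c)\<close> containing 1 carry \<open>c\<close> against \<open>y\<close>
      elsewhere, so row 1 repairs \<open>c'\<close>.\<close>
    obtain a' where a': "a' \<in> R" "\<And>i. i \<in> D \<Longrightarrow> \<pi> i a' = F i (\<lambda>N. \<pi> i (w a a a N))"
      using w_closed[of a a a] abcR by blast
    obtain b' where b': "b' \<in> R" "\<And>i. i \<in> D \<Longrightarrow> \<pi> i b' = F i (\<lambda>N. \<pi> i (w b a b N))"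
      using w_closed[of b a b] abcR by blast
    obtain c' where c': "c' \<in> R" "\<And>i. i \<in> D \<Longrightarrow> \<pi> i c' = F i (\<lambda>N. \<pi> i (w b a c N))"
      using w_closed[of b a c] abcR by blast
    have e_off: "\<pi> i (e (\<tau> k)) = y i" if "2 \<le> k" "k < d" "i \<in> D" "blk i \<noteq> \<tau> k" for i k
      using ey \<tau>[OF that(1,2)] that by auto
    \<comment> \<open>On blocks other than 0 and \<open>m\<close>, only the column
      \<open>{\<tau> (blk i)}\<close> can deviate from \<open>y\<close>, and the identity of its row
      absorbs it. On block \<open>m\<close> nothing deviates, as \<open>\<tau> k\<close> differs
      from \<open>m\<close> for \<open>k\<close> at least 2.\<close>
    have protect: "F i (\<lambda>N. \<pi> i (w \<alpha> \<beta> \<gamma> N)) = y i"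
      if i: "i \<in> D" "blk i \<noteq> 0" and h: "\<pi> i \<alpha> = y i" "\<pi> i \<beta> = y i" "\<pi> i \<gamma> = y i" for i \<alpha> \<beta> \<gamma>
    proof (cases "blk i = m")
      case True
      have "\<pi> i (w \<alpha> \<beta> \<gamma> N) = (if 0 \<in> N then y i else y i)" if "N \<in> mixes d {0, 1}" for N
        using that
        by (cases rule: mixes_01_cases) (use e_off \<tau> i True h in \<open>force simp: w_simps\<close>)+
      then show ?thesis using identI[of i 0 "y i" "y i"] i d y by simp
    next
      case False
      define k where "k = \<tau> (blk i)"
      have k: "2 \<le> k" "k < d"
        using False i blk[OF i(1)] Suc d by (auto simp: k_def \<tau>_def)
      have other: "blk i \<noteq> \<tau> k'" if "k' \<noteq> k" for k'
        using \<tau>\<tau>[of k'] that by (auto simp: k_def)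
      have "\<pi> i (w \<alpha> \<beta> \<gamma> N) = (if k \<in> N then \<pi> i (e (\<tau> k)) else y i)"
        if "N \<in> mixes d {0, 1}" for N
        using that by (cases rule: mixes_01_cases) (use e_off other k i h in \<open>auto simp: w_simps\<close>)
      then show ?thesis using identI[of i k "\<pi> i (e (\<tau> k))" "y i"] i k y mem eR by simp
    qed
    have "\<pi> i a' = \<pi> i b' \<and> \<pi> i c' = y i" if i: "i \<in> D" "blk i = 0" for i
    proof
      have h: "\<pi> i a = \<pi> i b" "\<pi> i c = y i" using abc i by (auto simp: P_def)
      have "\<pi> i (w a a a N) = \<pi> i (w b a b N)" if "N \<in> mixes d {0, 1}" for N
        using that by (cases rule: mixes_01_cases) (auto simp: w_simps h)
      then show "\<pi> i a' = \<pi> i b'"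
        unfolding a'(2)[OF i(1)] b'(2)[OF i(1)] by (rule cong[OF i(1)])
      have "\<pi> i (w b a c N) = (if 0 \<in> N then \<pi> i b else y i)" if "N \<in> mixes d {0, 1}" for N
        using that
        by (cases rule: mixes_01_cases) (use e_off \<tau> i h in \<open>force simp: w_simps\<close>)+
      then show "\<pi> i c' = y i"
        unfolding c'(2)[OF i(1)] using identI[of i 0 "\<pi> i b" "y i"] i d y mem abcR by simp
    qed
    moreover have "\<pi> i a' = y i \<and> \<pi> i b' = \<pi> i c'" if i: "i \<in> D" "blk i \<noteq> 0" for i
    proof
      have h: "\<pi> i a = y i" "\<pi> i b = \<pi> i c" using abc i by (auto simp: P_def)
      have "\<pi> i (w b a b N) = \<pi> i (w b a c N)" if "N \<in> mixes d {0, 1}" for N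
        using that by (cases rule: mixes_01_cases) (auto simp: w_simps h)
      then show "\<pi> i b' = \<pi> i c'"
        unfolding b'(2)[OF i(1)] c'(2)[OF i(1)] by (rule cong[OF i(1)])
      show "\<pi> i a' = y i"
        unfolding a'(2)[OF i(1)] using protect i h by blast
    qed
    moreover have "\<pi> i c' = y i" if i: "i \<in> D" "0 < blk i" "blk i < Suc m" for i
    proof (cases "blk i = m")
      case True
      have h: "\<pi> i a = y i" "\<pi> i b = \<pi> i c" using abc i by (auto simp: P_def)
      have "\<pi> i (w b a c N) = (if 1 \<in> N then \<pi> i c else y i)" if "N \<in> mixes d {0, 1}" for N
        using that
        by (cases rule: mixes_01_cases) (use e_off \<tau> i True h in \<open>force simp: w_simps\<close>)+
      then show ?thesis
        unfolding c'(2)[OF i(1)] using identI[of i 1 "\<pi> i c" "y i"] i d y mem abcR by simp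
    next
      case False
      \<comment> \<open>Here \<open>c\<close> is correct by the invariant, and \<open>b = c\<close>
        off block 0.\<close>
      then have "\<pi> i a = y i" "\<pi> i b = y i" "\<pi> i c = y i"
        using abc i by (auto simp: P_def)
      then show ?thesis
        unfolding c'(2)[OF i(1)] using protect i by blast
    qed
    ultimately have "P (Suc m) a' b' c'" using a'(1) b'(1) c'(1) unfolding P_def by blast
    then show ?case by blast
  qed
  from this[of d] obtain a b c where "P d a b c" using d by auto
  then have "\<pi> i c = y i" if "i \<in> D" for i
    using blk[OF that] that unfolding P_def by (cases "blk i = 0"; simp)
  moreover have "c \<in> R" using \<open>P d a b c\<close> unfolding P_def by blast
  ultimately show ?thesis by blast
qed

section \<open>Generation of the saturated subalgebra\<close>

lemma algebra_prod_alg: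
  assumes A: "\<And>i. i \<in> I \<Longrightarrow> algebra ar (A i)" and "universe (prod_alg I A) \<noteq> {}"
  shows "algebra ar (prod_alg I A)"
  unfolding algebra_def
proof (intro conjI allI impI)
  fix f xs assume xs: "length xs = ar f \<and> set xs \<subseteq> universe (prod_alg I A)"
  have "oper (A i) f (map (\<lambda>x. x i) xs) \<in> universe (A i)" if i: "i \<in> I" for i
  proof -
    have "set (map (\<lambda>x. x i) xs) \<subseteq> universe (A i)" using xs i by (auto simp: prod_alg_def)
    moreover have "length (map (\<lambda>x. x i) xs) = ar f" using xs by simp
    ultimately show ?thesis using A[OF i] unfolding algebra_def by blast
  qed
  then show "oper (prod_alg I A) f xs \<in> universe (prod_alg I A)" by (simp add: prod_alg_def)
qed (use assms in auto)

theorem theorem3p11: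
  fixes ar :: "'f \<Rightarrow> nat"
    and V :: "('f, 'u) ualg set"
    and d n :: nat
    and Bs :: "nat \<Rightarrow> ('f, 'u) ualg"
    and B B\<theta> :: "('f, nat \<Rightarrow> 'u) ualg"
    and \<theta>s :: "nat \<Rightarrow> ('u \<times> 'u) set"
    and \<theta> :: "((nat \<Rightarrow> 'u) \<times> (nat \<Rightarrow> 'u)) set"
    and G \<Lambda> \<Phi> :: "(nat \<Rightarrow> 'u) set"
  assumes V: "variety ar V"
    and d: "d > 1"
    and cube: "\<exists>t. cube_term ar V d t"
    and n: "n \<ge> d"
    and Bs: "\<forall>i\<in>{1..n}. Bs i \<in> V"
    and B: "subalgebra ar B (prod_alg {1..n} Bs)"
    and \<theta>s: "\<forall>i\<in>{1..n}. congruence ar (Bs i) (\<theta>s i)"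
    and \<theta>: "\<theta> = prod_rel {1..n} \<theta>s"
    and B\<theta>: "B\<theta> = saturation (prod_alg {1..n} Bs) \<theta> B"
    and G: "generating_set ar B G"
    and \<Lambda>: "\<Lambda> \<subseteq> universe B\<theta>"
    and \<Phi>: "\<Phi> \<subseteq> universe B\<theta>"
    and cond1: "\<forall>I. I \<subseteq> {1..n} \<and> card I = d - 1 \<longrightarrow>
      (\<forall>b' \<in> (\<lambda>b. restrict b I) ` universe B. \<forall>c' \<in> (\<lambda>c. restrict c I) ` universe B\<theta>.
        (b', c') \<in> prod_rel I \<theta>s \<longrightarrow>
        (\<exists>b\<in>universe B. \<exists>c\<in>\<Lambda>. restrict b I = b' \<and> restrict c I = c' \<and> (b, c) \<in> \<theta>))"
    and cond2: "\<forall>i\<in>{1..n}. \<forall>(\<beta>, \<gamma>) \<in> \<theta>s i. \<beta> \<in> (\<lambda>b. b i) ` universe B \<longrightarrow>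
      (\<exists>b\<in>universe B. \<exists>c\<in>\<Phi>. b i = \<beta> \<and> c i = \<gamma> \<and>
        restrict b {1..i - 1} = restrict c {1..i - 1} \<and> (b, c) \<in> \<theta>)"
  shows "generating_set ar B\<theta> (G \<union> \<Lambda> \<union> \<Phi>)"
proof -
  let ?A = "prod_alg {1..n} Bs"
  have alg: "algebra ar A" if "A \<in> V" for A
    using V that unfolding variety_def by auto
  have BA: "universe B \<subseteq> universe ?A" and algB: "algebra ar B"
    and operB: "\<And>f xs. length xs = ar f \<Longrightarrow> set xs \<subseteq> universe B \<Longrightarrow> oper B f xs = oper ?A f xs"
    using B by (auto simp: subalgebra_def)
  have con: "congruence ar ?A \<theta>"
    unfolding \<theta> using congruence_prod_rel \<theta>s by blast
  have algA: "algebra ar ?A"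
    using algB BA alg Bs by (intro algebra_prod_alg) (auto simp: algebra_def)
  have eq\<theta>: "equiv (universe ?A) \<theta>" using con by (simp add: congruence_def)
  have subB\<theta>: "subalgebra ar B\<theta> ?A" "universe B \<subseteq> universe B\<theta>"
    using subalgebra_saturation[OF algA B con] unfolding B\<theta> by auto
  have operB\<theta>: "oper B\<theta> = oper ?A" unfolding B\<theta> by (simp add: saturation_def)
  have memB\<theta>: "c \<in> universe B\<theta> \<longleftrightarrow> (\<exists>b\<in>universe B. (b, c) \<in> \<theta>)" for c
    unfolding B\<theta> by (auto simp: saturation_def)
  have \<theta>_refl: "(b, b) \<in> \<theta>" if "b \<in> universe B" for b
    using eq\<theta> BA that by (auto simp: equiv_def refl_on_def)
  have \<theta>D: "(b i, c i) \<in> \<theta>s i" if "(b, c) \<in> \<theta>" "i \<in> {1..n}" for b c i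
    using that unfolding \<theta> prod_rel_def by auto
  have \<theta>_upd: "(b, c(l := v)) \<in> \<theta>" if "(b, c) \<in> \<theta>" "l \<in> {1..n}" "(b l, v) \<in> \<theta>s l" for b c l v
    using that unfolding \<theta> prod_rel_def by (auto simp: extensional_def)
  have \<theta>A: "b \<in> universe ?A" "c \<in> universe ?A" if "(b, c) \<in> \<theta>" for b c
    using that eq\<theta> by (auto simp: equiv_def)
  have A_comp: "b i \<in> universe (Bs i)" if "b \<in> universe ?A" "i \<in> {1..n}" for b i
    using that by (auto simp: prod_alg_def)
  obtain t where t: "cube_family ar V d (mixes d {0, 1}) t"
    using cube cube_family_edge[OF alg] d by blast
  then have wf: "wf_uterm ar t" and vars: "vars_uterm t \<subseteq> mixes d {0, 1}"
    by (auto simp: cube_family_def)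
  have "universe B\<theta> \<subseteq> S" if S: "subuniverse ar B\<theta> S" and gen: "G \<union> \<Lambda> \<union> \<Phi> \<subseteq> S" for S
  proof -
    have SA: "subuniverse ar ?A S"
      using S subB\<theta>(1) unfolding subuniverse_def operB\<theta> subalgebra_def by blast
    have BsubA: "subuniverse ar ?A (universe B)"
      using BA algB operB by (fastforce simp: subuniverse_def algebra_def)
    \<comment> \<open>Generation by \<open>G\<close> is a statement about \<open>B\<close>, so
      \<open>S\<close> is first cut down to \<open>B\<close>.\<close>
    have "subuniverse ar B (S \<inter> universe B)"
      unfolding subuniverse_def
    proof (intro conjI allI impI)
      fix f xs assume xs: "length xs = ar f \<and> set xs \<subseteq> S \<inter> universe B"
      then have "oper B f xs = oper ?A f xs" using operB by blast
      then show "oper B f xs \<in> S \<inter> universe B"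
        using SA BsubA xs unfolding subuniverse_def by fastforce
    qed blast
    moreover have "G \<subseteq> S \<inter> universe B" using G gen by (auto simp: generating_set_def)
    ultimately have BS: "universe B \<subseteq> S"
      using G unfolding generating_set_def by blast
    define Q where "Q = {(b, c). b \<in> universe B \<and> c \<in> S \<and> (b, c) \<in> \<theta>}"
    define agree where "agree = (\<lambda>K (p :: (nat \<Rightarrow> 'u) \<times> (nat \<Rightarrow> 'u)) q.
      \<forall>i\<in>K. fst p i = fst q i \<and> snd p i = snd (q :: (nat \<Rightarrow> 'u) \<times> (nat \<Rightarrow> 'u)) i)"
    have diagQ: "(b, b) \<in> Q" if "b \<in> universe B" for b
      using that BS \<theta>_refl by (auto simp: Q_def)
    \<comment> \<open>A pair is read as one tuple whose coordinates \<open>(i, False)\<close> and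
      \<open>(i, True)\<close> come from its two components, so both are corrected at once.\<close>
    define \<pi> where "\<pi> = (\<lambda>(i, s) (p :: (nat \<Rightarrow> 'u) \<times> (nat \<Rightarrow> 'u)).
      if s then snd p i else fst p (i :: nat))"
    define F where "F = (\<lambda>(i :: nat, s :: bool) f. eval_uterm (Bs i) f t)"
    have Q_closed: "\<exists>r\<in>Q. \<forall>i\<in>{1..n} \<times> UNIV. \<pi> i r = F i (\<lambda>N. \<pi> i (w N))"
      if "\<And>N. w N \<in> Q" for w
    proof -
      define b where "b = eval_uterm ?A (\<lambda>N. fst (w N)) t"
      define c where "c = eval_uterm ?A (\<lambda>N. snd (w N)) t"
      have w: "fst (w N) \<in> universe B" "snd (w N) \<in> S" "(fst (w N), snd (w N)) \<in> \<theta>" for N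
        using that[of N] by (auto simp: Q_def)
      have "b \<in> universe B" "c \<in> S" "(b, c) \<in> \<theta>"
        unfolding b_def c_def using wf w BsubA SA con
        by (auto intro: eval_uterm_in_subuniverse eval_uterm_congruence)
      then have "(b, c) \<in> Q" by (simp add: Q_def)
      moreover have "\<pi> i (b, c) = F i (\<lambda>N. \<pi> i (w N))" if "i \<in> {1..n} \<times> UNIV" for i
        using that by (auto simp: \<pi>_def F_def b_def c_def eval_uterm_prod_alg)
      ultimately show ?thesis by blast
    qed
    have exchange: "\<exists>r\<in>Q. agree J r (b, c)"
      if J: "J \<subseteq> {1..n}" "d \<le> card J" "l \<in> J"
        and IH: "\<And>K b c. K \<subset> J \<Longrightarrow> b \<in> universe B \<Longrightarrow> (b, c) \<in> \<theta> \<Longrightarrow> \<exists>r\<in>Q. agree K r (b, c)"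
        and bc: "b \<in> universe B" "(b, c) \<in> \<theta>"
        and Q: "p \<in> Q" "q \<in> Q" "q' \<in> Q"
        and ag: "agree (J - {l}) p (b, c)" "agree {l} p q" "agree (J - {l}) q q'" "agree {l} q' (b, c)"
      for J l b c p q q'
    proof -
      have finJ: "finite J" using J(1) finite_subset by blast
      then have "d - 1 \<le> card (J - {l})" using J by simp
      then obtain J0 where J0: "J0 \<subseteq> J - {l}" "card J0 = d - 1" "finite J0"
        by (meson obtain_subset_with_card_n)
      then obtain f where f: "bij_betw f J0 {1..<d}"
        using finite_same_card_bij[of J0 "{1..<d}"] by auto
      \<comment> \<open>Each nonzero block contains exactly one index of \<open>J0\<close>, and a
        pair wrong only at that index is correct off the block. The other indices of
        \<open>J - {l}\<close> may join any block, here block 1.\<close>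
      define blk where "blk = (\<lambda>(i, s :: bool). if i = l then 0 else if i \<in> J0 then f i else 1)"
      have fJ0: "1 \<le> f i" "f i < d" if "i \<in> J0" for i
        using f that by (auto dest: bij_betwE)
      have blk0: "blk (i, s) = 0 \<longleftrightarrow> i = l" for i s
        using fJ0[of i] by (auto simp: blk_def)
      define y where "y = (\<lambda>i. \<pi> i (b, c))"
      have "\<exists>r\<in>Q. \<forall>i\<in>J \<times> UNIV. \<pi> i r = y i"
      proof (rule edge_exchange[where F = F and d = d and blk = blk and a = p and b = q and c = q'
            and car = "\<lambda>i. universe (Bs (fst i))"])
        show "\<exists>r\<in>Q. \<forall>i\<in>J \<times> UNIV. \<pi> i r = F i (\<lambda>N. \<pi> i (w N))" if "\<And>N. w N \<in> Q" for w
          using Q_closed[of w, OF that] J(1) by blast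
        show "F i g = F i h" if "\<And>N. N \<in> mixes d {0, 1} \<Longrightarrow> g N = h N" for i g h
          unfolding F_def using that vars by (auto split: prod.split intro!: eval_uterm_cong)
        show "F i (\<lambda>N. if k \<in> N then u else v) = v"
          if "i \<in> J \<times> UNIV" "k < d" "u \<in> universe (Bs (fst i))" "v \<in> universe (Bs (fst i))" for i k u v
        proof -
          have "Bs (fst i) \<in> V" using that Bs J(1) by auto
          then show ?thesis using t that unfolding cube_family_def F_def by (auto split: prod.split)
        qed
        have car: "\<pi> i (b, c) \<in> universe (Bs (fst i))"
          if "i \<in> J \<times> UNIV" "(b, c) \<in> \<theta>" for i b c
        proof -
          have i: "fst i \<in> {1..n}" using that J(1) by auto
          show ?thesis
            using A_comp[OF \<theta>A(1)[OF that(2)] i] A_comp[OF \<theta>A(2)[OF that(2)] i]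
            by (simp add: \<pi>_def split_beta)
        qed
        show "\<pi> i r \<in> universe (Bs (fst i))" if "i \<in> J \<times> UNIV" "r \<in> Q" for i r
          using car[OF that(1), of "fst r" "snd r"] that(2) by (auto simp: Q_def)
        show "y i \<in> universe (Bs (fst i))" if "i \<in> J \<times> UNIV" for i
          unfolding y_def using car[OF that bc(2)] .
        show "d > 1" by (rule d)
        show "blk i < d" for i using fJ0 d by (auto simp: blk_def split: prod.split)
        show "\<exists>r\<in>Q. \<forall>i\<in>J \<times> UNIV. blk i \<noteq> k \<longrightarrow> \<pi> i r = y i" if k: "1 \<le> k" "k < d" for k
        proof -
          have "k \<in> f ` J0" using bij_betw_imp_surj_on[OF f] k by simp
          then obtain j where j: "j \<in> J0" "f j = k" by blast
          then have "J - {j} \<subset> J" using J0 by blast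
          from IH[OF this bc] obtain r where r: "r \<in> Q" "agree (J - {j}) r (b, c)" by blast
          moreover have "\<pi> i r = y i" if "i \<in> J \<times> UNIV" "blk i \<noteq> k" for i
          proof -
            have "fst i \<in> J - {j}" using that j J0(1)
              by (auto simp: blk_def split: if_splits)
            then show ?thesis using r(2) by (auto simp: agree_def \<pi>_def y_def split_beta)
          qed
          ultimately show ?thesis by blast
        qed
        show "\<pi> i p = \<pi> i q \<and> \<pi> i q' = y i" if "i \<in> J \<times> UNIV" "blk i = 0" for i
          using that ag blk0 by (cases i) (auto simp: agree_def \<pi>_def y_def)
        show "\<pi> i p = y i \<and> \<pi> i q = \<pi> i q'" if "i \<in> J \<times> UNIV" "blk i \<noteq> 0" for i
          using that ag blk0 by (cases i) (auto simp: agree_def \<pi>_def y_def)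
      qed (use Q in auto)
      then obtain r where r: "r \<in> Q" "\<And>i. i \<in> J \<times> UNIV \<Longrightarrow> \<pi> i r = y i" by blast
      have "agree J r (b, c)"
        unfolding agree_def
      proof
        fix i assume "i \<in> J"
        then show "fst r i = fst (b, c) i \<and> snd r i = snd (b, c) i"
          using r(2)[of "(i, False)"] r(2)[of "(i, True)"] by (simp add: \<pi>_def y_def)
      qed
      then show ?thesis using r(1) by blast
    qed
    have extend: "\<exists>r\<in>Q. agree J r (b, c)"
      if "J \<subseteq> {1..n}" "b \<in> universe B" "(b, c) \<in> \<theta>" for J b c
    proof -
      have "finite J" using that(1) finite_subset by blast
      then show ?thesis using that
      proof (induction J arbitrary: b c rule: finite_psubset_induct)
        case (psubset J)
        note bB = psubset.prems(2) and bc = psubset.prems(3)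
        have IH: "\<exists>r\<in>Q. agree K r (b, c)" if "K \<subset> J" "b \<in> universe B" "(b, c) \<in> \<theta>" for K b c
          using psubset.IH[OF that(1)] psubset.prems(1) that by blast
        show ?case
        proof (cases "card J < d")
          case True
          \<comment> \<open>Condition (1) concerns sets of size exactly \<open>d - 1\<close>, so
            \<open>J\<close> is enlarged to one; \<open>n\<close> is large enough for this.\<close>
          then have "card J \<le> d - 1" "d - 1 \<le> card {1..n}" using n by auto
          then obtain I where I: "J \<subseteq> I" "I \<subseteq> {1..n}" "card I = d - 1"
            using exists_subset_between[of J "d - 1" "{1..n}"] psubset.prems(1) by blast
          have "(restrict b I, restrict c I) \<in> prod_rel I \<theta>s"
            using \<theta>D[OF bc] I(2) by (auto simp: prod_rel_def)
          moreover have "c \<in> universe B\<theta>" using bc bB memB\<theta> by blast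
          ultimately obtain b' c' where "b' \<in> universe B" "c' \<in> \<Lambda>" "(b', c') \<in> \<theta>"
            and r: "restrict b' I = restrict b I" "restrict c' I = restrict c I"
            using cond1 I(2,3) bB by blast
          then have "(b', c') \<in> Q" using gen by (auto simp: Q_def)
          moreover have "agree J (b', c') (b, c)"
            using I(1) fun_cong[OF r(1)] fun_cong[OF r(2)] unfolding agree_def
            by (fastforce simp: restrict_def split: if_splits)
          ultimately show ?thesis by blast
        next
          case False
          then have dJ: "d \<le> card J" by simp
          then have "J \<noteq> {}" using d by auto
          \<comment> \<open>Choosing the maximum puts \<open>J - {l}\<close> inside
            \<open>[l - 1]\<close>, where condition (2) provides agreement.\<close>
          define l where "l = Max J"
          have lJ: "l \<in> J" unfolding l_def using psubset.hyps \<open>J \<noteq> {}\<close> by simp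
          then have ln: "l \<in> {1..n}" using psubset.prems(1) by blast
          have below: "J - {l} \<subseteq> {1..l - 1}"
          proof
            fix i assume i: "i \<in> J - {l}"
            then have "i \<le> l" unfolding l_def using psubset.hyps by simp
            then show "i \<in> {1..l - 1}" using i psubset.prems(1) by auto
          qed
          have fork: "\<exists>u\<in>universe B. \<exists>v. (u, v) \<in> Q \<and> u l = b l \<and> v l = g \<and> (\<forall>i\<in>J - {l}. u i = v i)"
            if "b \<in> universe B" "(b l, g) \<in> \<theta>s l" for b g
          proof -
            have "\<exists>u\<in>universe B. \<exists>v\<in>\<Phi>. u l = b l \<and> v l = g \<and>
                restrict u {1..l - 1} = restrict v {1..l - 1} \<and> (u, v) \<in> \<theta>"
              using bspec[OF bspec[OF cond2 ln] that(2)] that(1) unfolding prod.case by blast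
            then obtain u v where uv: "u \<in> universe B" "v \<in> \<Phi>" "u l = b l" "v l = g"
              "restrict u {1..l - 1} = restrict v {1..l - 1}" "(u, v) \<in> \<theta>"
              by blast
            have "u i = v i" if "i \<in> J - {l}" for i
              using fun_cong[OF uv(5), of i] below that by (auto simp: restrict_def split: if_splits)
            then show ?thesis using uv gen unfolding Q_def by blast
          qed
          have ex: "\<exists>r\<in>Q. agree J r (b, c)"
            if "b \<in> universe B" "(b, c) \<in> \<theta>" "p \<in> Q" "q \<in> Q" "q' \<in> Q"
              "agree (J - {l}) p (b, c)" "agree {l} p q" "agree (J - {l}) q q'" "agree {l} q' (b, c)"
            for b c p q q'
            by (rule exchange[OF psubset.prems(1) dJ lJ IH that])
          \<comment> \<open>At \<open>l\<close> the pair \<open>(r', r)\<close> is moved to \<open>(r', r')\<close>, then to \<open>(b, b)\<close> and finally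
            to \<open>(b, c)\<close>.\<close>
          obtain r' r where rQ: "(r', r) \<in> Q" and r: "agree (J - {l}) (r', r) (b, c)"
            using IH[of "J - {l}" b c] lJ bB bc by fastforce
          have r': "r' \<in> universe B" "(r', r) \<in> \<theta>" using rQ by (auto simp: Q_def)
          \<comment> \<open>The fork is \<open>(u, v)\<close>, \<open>(u, u)\<close>: these differ
            only in the second component, where \<open>u\<close> and \<open>v\<close> coincide on
            \<open>J - {l}\<close>.\<close>
          obtain u v where uv: "u \<in> universe B" "(u, v) \<in> Q" "u l = r' l" "v l = r l"
            "\<forall>i\<in>J - {l}. u i = v i"
            using fork[OF r'(1) \<theta>D[OF r'(2) ln]] by blast
          obtain p where p: "p \<in> Q" "agree J p (r', r(l := r' l))"
            using ex[of r' "r(l := r' l)" "(r', r)" "(u, v)" "(u, u)"] r' rQ uv diagQ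
              \<theta>_upd[OF r'(2) ln] \<theta>D[OF \<theta>_refl[OF r'(1)] ln]
            by (auto simp: agree_def)
          have "(b, c(l := b l)) \<in> \<theta>" using \<theta>_upd[OF bc ln] \<theta>D[OF \<theta>_refl[OF bB] ln] by blast
          \<comment> \<open>The fork is \<open>(r', r')\<close>, \<open>(b, b)\<close>: diagonal
            pairs over \<open>B\<close> lie in \<open>Q\<close>, and \<open>r'\<close> agrees with
            \<open>b\<close> on \<open>J - {l}\<close>.\<close>
          then obtain q where q: "q \<in> Q" "agree J q (b, c(l := b l))"
            using ex[of b "c(l := b l)" p "(r', r')" "(b, b)"] bB r r' p diagQ lJ
            by (auto simp: agree_def)
          \<comment> \<open>This fork is used in the opposite direction, from
            \<open>(u', u')\<close> to \<open>(u', v')\<close>.\<close>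
          obtain u' v' where uv': "u' \<in> universe B" "(u', v') \<in> Q" "u' l = b l" "v' l = c l"
            "\<forall>i\<in>J - {l}. u' i = v' i"
            using fork[OF bB \<theta>D[OF bc ln]] by blast
          show ?thesis
            using ex[of b c q "(u', u')" "(u', v')"] bB bc q uv' diagQ lJ
            by (auto simp: agree_def)
        qed
      qed
    qed
    show ?thesis
    proof
      fix c assume "c \<in> universe B\<theta>"
      then obtain b where b: "b \<in> universe B" "(b, c) \<in> \<theta>" using memB\<theta> by blast
      obtain b' c' where r: "(b', c') \<in> Q" "agree {1..n} (b', c') (b, c)"
        using extend[OF order_refl b] by fastforce
      have "(b', c') \<in> \<theta>" "c' \<in> S" using r(1) by (auto simp: Q_def)
      then have "c' = c"
        using b(2) r(2) unfolding \<theta> prod_rel_def agree_def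
        by (auto intro: extensionalityI)
      then show "c \<in> S" using \<open>c' \<in> S\<close> by simp
    qed
  qed
  moreover have "G \<union> \<Lambda> \<union> \<Phi> \<subseteq> universe B\<theta>"
    using G \<Lambda> \<Phi> subB\<theta>(2) by (auto simp: generating_set_def)
  moreover have "subuniverse ar B\<theta> (universe B\<theta>)"
    using subB\<theta>(1) by (intro subuniverse_universe) (simp add: subalgebra_def)
  ultimately show ?thesis unfolding generating_set_def by blast
qed

end
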